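(* Let $p$ be a prime, $r\ge 1$ an integer, and let $f\in\mathbb{Q}[x]$ be a $p^r$-pure polynomial of degree $d$. Then for every $n\ge 1$, the iterate $f^n$ has at most $\gcd(d^n,r)$ irreducible factors over $\mathbb{Q}$, and each irreducible factor of $f^n$ has degree at least $\frac{d^n}{\gcd(d^n,r)}$. Moreover, $f$ is eventually stable over $\mathbb{Q}$.
   Context: $\nu_p$ denotes the $p$-adic valuation on $\mathbb{Q}$ (with $\nu_p(0)=\infty$). A polynomial $f(x)=a_dx^d+\dots+a_0\in\mathbb{Q}[x]$ of degree $d$ is $p^r$-pure if $\nu_p(a_d)=0$, $\nu_p(a_0)=r$, and $\frac{\nu_p(a_i)}{d-i}\ge \frac{r}{d}$ for all $1\le i\le d-1$. $f^n$ denotes the $n$-fold composition $f\circ\cdots\circ f$. A polynomial $f\in\mathbb{Q}[x]$ is eventually stable over $\mathbb{Q}$ if there is a constant $C$ such that the number of irreducible factors over $\mathbb{Q}$ of $f^n$ is at most $C$ for all $n\ge 1$. *)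

theory Defs
  imports "HOL-Computational_Algebra.Computational_Algebra" "HOL-Computational_Algebra.Field_as_Ring"
    "HOL-Library.Extended_Real"
begin

definition padic_val :: "nat \<Rightarrow> rat \<Rightarrow> ereal" where
  "padic_val p x =
     (if x = 0 then \<infinity>
      else ereal (real (multiplicity (int p) (fst (quotient_of x)))
                - real (multiplicity (int p) (snd (quotient_of x)))))"

definition pure_poly :: "nat \<Rightarrow> nat \<Rightarrow> rat poly \<Rightarrow> bool" where
  "pure_poly p r f \<longleftrightarrow>
     padic_val p (lead_coeff f) = 0 \<and>
     padic_val p (coeff f 0) = ereal (real r) \<and>
     (\<forall>i. 1 \<le> i \<and> i < degree f \<longrightarrow>
        padic_val p (coeff f i) / ereal (real (degree f - i)) \<ge> ereal (real r / real (degree f)))"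

definition iterate_poly :: "'a :: comm_semiring_1 poly \<Rightarrow> nat \<Rightarrow> 'a poly" where
  "iterate_poly f n = (pcompose f ^^ n) [:0, 1:]"

text \<open>Irreducible factors are counted with multiplicity, up to associates. The zero polynomial
  gets the value 0; for nonconstant polynomials no iterate is zero.\<close>

definition num_irreducible_factors :: "rat poly \<Rightarrow> nat" where
  "num_irreducible_factors f = size (prime_factorization f)"

definition eventually_stable :: "rat poly \<Rightarrow> bool" where
  "eventually_stable f \<longleftrightarrow> (\<exists>C. \<forall>n\<ge>1. num_irreducible_factors (iterate_poly f n) \<le> C)"

end

theory Submission imports Defs begin

text \<open>Weight the monomial \<open>a x\<^sup>i\<close> by \<open>D \<nu>(a) + r i\<close>. For \<open>d \<ge> 2\<close> purity is inherited by iterates: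
  if \<open>f\<close> and \<open>g\<close> are \<open>p\<^sup>r\<close>-pure of degrees \<open>d\<close> and \<open>D\<close>, then \<open>f \<circ> g\<close> is \<open>p\<^sup>r\<close>-pure of degree \<open>d D\<close>.
  In a pure polynomial of degree \<open>D\<close> both extreme monomials have the minimal weight \<open>D r\<close>. By the
  weighted Gauss lemma minimal weights are additive under multiplication, so both extreme monomials
  of every factor \<open>u\<close> have minimal weight too. Hence \<open>r deg u = D (\<nu>(u\<^sub>0) - \<nu>(lc u))\<close>, which
  forces \<open>D / gcd D r\<close> to divide \<open>deg u\<close>. For \<open>d = 1\<close> purity of iterates may fail
  (as for \<open>x + p\<close>), but the iterates are linear.\<close>

section \<open>Weighted Gauss lemma over a valued field\<close>

text \<open>The value \<open>v 0\<close> is left arbitrary, standing in for infinity; hence every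
  statement about \<open>v\<close> is guarded by nonzero arguments.\<close>

locale valuation =
  fixes v :: "'a :: field \<Rightarrow> int"
  assumes val_mult: "x \<noteq> 0 \<Longrightarrow> y \<noteq> 0 \<Longrightarrow> v (x * y) = v x + v y"
    and val_add: "x \<noteq> 0 \<Longrightarrow> y \<noteq> 0 \<Longrightarrow> x + y \<noteq> 0 \<Longrightarrow> min (v x) (v y) \<le> v (x + y)"
begin

lemma val_one: "v 1 = 0"
  using val_mult[of 1 1] by simp

lemma val_uminus:
  assumes "x \<noteq> 0"
  shows "v (- x) = v x"
proof -
  have "v (-1) + v (-1) = 0"
    using val_mult[of "-1" "-1"] val_one by simp
  then show ?thesis
    using val_mult[of "-1" x] assms by simp
qed

lemma val_power: "x \<noteq> 0 \<Longrightarrow> v (x ^ n) = int n * v x"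
  by (induction n) (simp_all add: val_one val_mult algebra_simps)

text \<open>Writing \<open>x\<close> as \<open>(x + y) + (- y)\<close> shows that
  \<open>v (x + y)\<close> cannot exceed \<open>v x\<close> when \<open>v y\<close> does.\<close>

lemma val_add_dominant:
  assumes "x \<noteq> 0" and "y \<noteq> 0 \<Longrightarrow> v x < v y"
  shows "x + y \<noteq> 0" and "v (x + y) = v x"
proof -
  have "x + y \<noteq> 0 \<and> v (x + y) = v x"
  proof (cases "y = 0")
    case False
    have nz: "x + y \<noteq> 0"
    proof
      assume "x + y = 0"
      then have "y = - x" by (simp add: add_eq_0_iff)
      then show False using assms False val_uminus[of x] by auto
    qed
    have "min (v x) (v y) \<le> v (x + y)"
      using val_add assms(1) False nz by blast
    moreover have "min (v (x + y)) (v (- y)) \<le> v (x + y + - y)"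
      using val_add[of "x + y" "- y"] nz False assms(1) by simp
    ultimately show ?thesis
      using assms(2)[OF False] val_uminus[OF False] nz by simp
  qed (use assms in auto)
  then show "x + y \<noteq> 0" and "v (x + y) = v x" by auto
qed

text \<open>The ultrametric inequality is scaled by \<open>a\<close> so that weight bounds apply
  directly, without dividing by \<open>a\<close>.\<close>

lemma val_sum_ge:
  fixes a k :: int
  assumes "finite A" and "a \<ge> 0" and "\<And>i. i \<in> A \<Longrightarrow> g i \<noteq> 0 \<Longrightarrow> k \<le> a * v (g i)"
    and "sum g A \<noteq> 0"
  shows "k \<le> a * v (sum g A)"
  using assms(1,3,4)
proof (induction A rule: finite_induct)
  case (insert x A)
  show ?case
  proof (cases "g x = 0 \<or> sum g A = 0")
    case True
    then show ?thesis using insert by auto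
  next
    case False
    have "min (v (g x)) (v (sum g A)) \<le> v (g x + sum g A)"
      using val_add False insert by auto
    then have "a * min (v (g x)) (v (sum g A)) \<le> a * v (g x + sum g A)"
      using assms(2) by (rule mult_left_mono)
    moreover have "k \<le> a * v (g x)" "k \<le> a * v (sum g A)"
      using insert False by auto
    ultimately show ?thesis
      using insert.hyps by (auto simp: min_def split: if_splits)
  qed
qed simp

text \<open>For \<open>a > 0\<close> this says that the Newton polygon lies on or above a line of
  slope \<open>-b/a\<close>; integer weights avoid rational slopes. As a lower bound rather than a
  minimum, it also makes sense for the zero polynomial.\<close>

definition weight_ge :: "int \<Rightarrow> int \<Rightarrow> int \<Rightarrow> 'a poly \<Rightarrow> bool" where
  "weight_ge a b k h \<longleftrightarrow> (\<forall>i. coeff h i \<noteq> 0 \<longrightarrow> k \<le> a * v (coeff h i) + b * int i)"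

definition weight_attained :: "int \<Rightarrow> int \<Rightarrow> int \<Rightarrow> 'a poly \<Rightarrow> bool" where
  "weight_attained a b k h \<longleftrightarrow> (\<exists>i. coeff h i \<noteq> 0 \<and> k = a * v (coeff h i) + b * int i)"

lemma weight_geD: "weight_ge a b k h \<Longrightarrow> coeff h i \<noteq> 0 \<Longrightarrow> k \<le> a * v (coeff h i) + b * int i"
  by (simp add: weight_ge_def)

lemma weight_ge_add:
  assumes "a \<ge> 0" and "weight_ge a b k g" and "weight_ge a b k h"
  shows "weight_ge a b k (g + h)"
  unfolding weight_ge_def
proof (intro allI impI)
  fix i assume nz: "coeff (g + h) i \<noteq> 0"
  \<comment> \<open>A sum over two indices lets \<open>val_sum_ge\<close> absorb the cases where one
    summand vanishes.\<close>
  have "k - b * int i \<le> a * v (\<Sum>x\<in>{True, False}. if x then coeff g i else coeff h i)"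
    using assms nz by (intro val_sum_ge) (auto dest: weight_geD[of _ _ _ _ i])
  then show "k \<le> a * v (coeff (g + h) i) + b * int i" by simp
qed

lemma weight_ge_mult:
  assumes "a \<ge> 0" and "weight_ge a b k g" and "weight_ge a b l h"
  shows "weight_ge a b (k + l) (g * h)"
  unfolding weight_ge_def
proof (intro allI impI)
  fix n assume nz: "coeff (g * h) n \<noteq> 0"
  have "k + l - b * int n \<le> a * v (\<Sum>i\<le>n. coeff g i * coeff h (n - i))"
  proof (intro val_sum_ge)
    fix i assume i: "i \<in> {..n}" "coeff g i * coeff h (n - i) \<noteq> 0"
    then have "k \<le> a * v (coeff g i) + b * int i"
      and "l \<le> a * v (coeff h (n - i)) + b * int (n - i)"
      using assms by (auto dest: weight_geD)
    then show "k + l - b * int n \<le> a * v (coeff g i * coeff h (n - i))"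
      using i by (simp add: val_mult of_nat_diff algebra_simps)
  qed (use assms nz in \<open>auto simp: coeff_mult\<close>)
  then show "k + l \<le> a * v (coeff (g * h) n) + b * int n"
    by (simp add: coeff_mult)
qed

lemma weight_ge_const: "(c \<noteq> 0 \<Longrightarrow> k \<le> a * v c) \<Longrightarrow> weight_ge a b k [:c:]"
  by (auto simp: weight_ge_def coeff_pCons split: nat.splits)

text \<open>Since \<open>g\<close> replaces the variable of \<open>f\<close>, that variable is given
  the weight \<open>l\<close> of \<open>g\<close>. The induction follows Horner's scheme: dropping
  the constant term lowers all exponents by one and the bound by \<open>l\<close>.\<close>

lemma weight_ge_pcompose:
  assumes "a \<ge> 0" and "weight_ge a b l g" and "weight_ge a l k f"
  shows "weight_ge a b k (pcompose f g)"
  using assms(3)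
proof (induction f arbitrary: k)
  case 0
  then show ?case by (simp add: weight_ge_def)
next
  case (pCons c f)
  have "weight_ge a l (k - l) f"
    unfolding weight_ge_def
  proof (intro allI impI)
    fix i assume "coeff f i \<noteq> 0"
    then show "k - l \<le> a * v (coeff f i) + l * int i"
      using weight_geD[OF pCons.prems, of "Suc i"] by (simp add: algebra_simps)
  qed
  then have "weight_ge a b (l + (k - l)) (g * pcompose f g)"
    using assms pCons.IH by (intro weight_ge_mult) auto
  moreover have "weight_ge a b k [:c:]"
    using weight_geD[OF pCons.prems, of 0] by (intro weight_ge_const) simp
  ultimately show ?case
    using assms(1) by (simp add: pcompose_pCons weight_ge_add)
qed

lemma ex_min_weight:
  assumes "h \<noteq> 0"
  obtains k where "weight_ge a b k h" and "weight_attained a b k h"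
proof -
  let ?W = "(\<lambda>i. a * v (coeff h i) + b * int i) ` {i. coeff h i \<noteq> 0}"
  have fin: "finite {i. coeff h i \<noteq> 0}"
    by (rule finite_subset[of _ "{..degree h}"]) (auto intro: le_degree)
  have "degree h \<in> {i. coeff h i \<noteq> 0}" using assms by simp
  then have "?W \<noteq> {}" by blast
  then have "Min ?W \<in> ?W" using fin by (intro Min_in) auto
  then have "weight_attained a b (Min ?W) h" unfolding weight_attained_def by blast
  moreover have "weight_ge a b (Min ?W) h"
    using fin by (auto simp: weight_ge_def intro!: Min_le)
  ultimately show ?thesis using that by blast
qed

text \<open>With \<open>i\<close> and \<open>j\<close> the least indices attaining the minimal weights of \<open>g\<close> and \<open>h\<close>, exactly one
  summand of the \<open>(i + j)\<close>-th coefficient of \<open>g * h\<close> has minimal valuation.\<close>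

lemma weight_attained_mult:
  assumes "a > 0"
    and g: "weight_ge a b k g" "weight_attained a b k g"
    and h: "weight_ge a b l h" "weight_attained a b l h"
  shows "weight_attained a b (k + l) (g * h)"
proof -
  define P where "P = (\<lambda>k h i. coeff h i \<noteq> 0 \<and> k = a * v (coeff h i) + b * int i)"
  define i where "i = (LEAST i. P k g i)"
  define j where "j = (LEAST j. P l h j)"
  have i: "P k g i" "\<And>i'. i' < i \<Longrightarrow> \<not> P k g i'"
    using g(2) LeastI_ex[of "P k g"] not_less_Least[of _ "P k g"]
    unfolding weight_attained_def P_def i_def by blast+
  have j: "P l h j" "\<And>j'. j' < j \<Longrightarrow> \<not> P l h j'"
    using h(2) LeastI_ex[of "P l h"] not_less_Least[of _ "P l h"]
    unfolding weight_attained_def P_def j_def by blast+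
  let ?t = "\<lambda>m. coeff g m * coeff h (i + j - m)"
  let ?s = "sum ?t ({..i + j} - {i})"
  have nz: "?t i \<noteq> 0" and ti: "a * v (?t i) = k + l - b * int (i + j)"
    using i(1) j(1) by (auto simp: P_def val_mult algebra_simps)
  have split: "coeff (g * h) (i + j) = ?t i + ?s"
    unfolding coeff_mult by (rule sum.remove) auto
  have dom: "v (?t i) < v ?s" if "?s \<noteq> 0"
  proof -
    \<comment> \<open>Over the integers, the strict inequality becomes a bound of the form that
      \<open>val_sum_ge\<close> accepts.\<close>
    have "a * v (?t i) + 1 \<le> a * v ?s"
    proof (intro val_sum_ge that)
      fix m assume m: "m \<in> {..i + j} - {i}" "?t m \<noteq> 0"
      then have c: "coeff g m \<noteq> 0" "coeff h (i + j - m) \<noteq> 0" by auto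
      have gm: "k \<le> a * v (coeff g m) + b * int m"
        and hm: "l \<le> a * v (coeff h (i + j - m)) + b * int (i + j - m)"
        using g h c by (auto dest: weight_geD)
      have "m < i \<or> i + j - m < j" using m by auto
      then have "k < a * v (coeff g m) + b * int m \<or>
          l < a * v (coeff h (i + j - m)) + b * int (i + j - m)"
        using i(2)[of m] j(2)[of "i + j - m"] c gm hm unfolding P_def by linarith
      then have "k + l < a * v (coeff g m) + b * int m +
          (a * v (coeff h (i + j - m)) + b * int (i + j - m))"
        using gm hm by linarith
      also have "\<dots> = a * v (?t m) + b * int (i + j)"
        using m c by (simp add: val_mult of_nat_diff algebra_simps)
      finally show "a * v (?t i) + 1 \<le> a * v (?t m)" using ti by linarith
    qed (use assms in auto)
    then have "a * v (?t i) < a * v ?s" by linarith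
    then show ?thesis using assms(1) by simp
  qed
  have "coeff (g * h) (i + j) \<noteq> 0" "v (coeff (g * h) (i + j)) = v (?t i)"
    unfolding split using val_add_dominant[OF nz dom] by blast+
  then show ?thesis
    unfolding weight_attained_def using ti by (intro exI[of _ "i + j"]) simp
qed

section \<open>Pure polynomials\<close>

definition pure :: "nat \<Rightarrow> 'a poly \<Rightarrow> bool" where
  "pure r h \<longleftrightarrow> degree h > 0 \<and> coeff h 0 \<noteq> 0 \<and> v (coeff h 0) = int r \<and> v (lead_coeff h) = 0 \<and>
     weight_ge (int (degree h)) (int r) (int (degree h) * int r) h"

lemma pure_dvd_imp_degree_dvd:
  assumes "pure r h" and "u dvd h"
  shows "degree h dvd r * degree u"
proof -
  obtain w where h: "h = u * w" using assms(2) by blast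
  let ?D = "int (degree h)"
  have D: "?D > 0" and h0: "coeff h 0 \<noteq> 0" and vh: "v (coeff h 0) = int r" "v (lead_coeff h) = 0"
    and wh: "weight_ge ?D (int r) (?D * int r) h"
    using assms(1) by (auto simp: pure_def)
  have u0: "coeff u 0 \<noteq> 0" and w0: "coeff w 0 \<noteq> 0"
    using h0 unfolding h by (auto simp: coeff_mult_0)
  then have nz: "u \<noteq> 0" "w \<noteq> 0" by auto
  obtain k where k: "weight_ge ?D (int r) k u" "weight_attained ?D (int r) k u"
    using ex_min_weight nz by blast
  obtain l where l: "weight_ge ?D (int r) l w" "weight_attained ?D (int r) l w"
    using ex_min_weight nz by blast
  have "weight_attained ?D (int r) (k + l) h"
    using weight_attained_mult[OF D k l] h by simp
  then have kl: "?D * int r \<le> k + l"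
    using wh by (auto simp: weight_attained_def dest: weight_geD)
  have "int r = v (coeff u 0) + v (coeff w 0)"
    using vh(1) u0 w0 unfolding h by (simp add: coeff_mult_0 val_mult)
  then have "?D * int r = ?D * v (coeff u 0) + ?D * v (coeff w 0)"
    by (simp add: algebra_simps)
  moreover have "k \<le> ?D * v (coeff u 0)" "l \<le> ?D * v (coeff w 0)"
    using weight_geD[OF k(1) u0] weight_geD[OF l(1) w0] by simp_all
  \<comment> \<open>The upper bounds for \<open>k\<close> and \<open>l\<close> add up to
    \<open>?D * int r\<close>, which is at most \<open>k + l\<close>, so both are equalities. The
    leading coefficients are squeezed in the same way below.\<close>
  ultimately have ku: "k = ?D * v (coeff u 0)"
    using kl by linarith
  have "0 = v (lead_coeff u) + v (lead_coeff w)"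
    using vh(2) nz unfolding h by (simp add: lead_coeff_mult val_mult)
  then have "0 = ?D * v (lead_coeff u) + ?D * v (lead_coeff w)"
    by (metis distrib_left mult_zero_right)
  moreover have "?D * int r = int r * int (degree u) + int r * int (degree w)"
    using nz unfolding h by (simp add: degree_mult_eq algebra_simps)
  moreover have "k \<le> ?D * v (lead_coeff u) + int r * int (degree u)"
    "l \<le> ?D * v (lead_coeff w) + int r * int (degree w)"
    using weight_geD[OF k(1)] weight_geD[OF l(1)] nz by simp_all
  ultimately have "k = ?D * v (lead_coeff u) + int r * int (degree u)"
    using kl by linarith
  with ku have "int r * int (degree u) = ?D * (v (coeff u 0) - v (lead_coeff u))"
    by (simp add: algebra_simps)
  then have "int (degree h) dvd int (r * degree u)" by simp
  then show ?thesis by (simp only: of_nat_dvd_iff)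
qed

lemma pure_pcompose:
  assumes f: "pure r f" and g: "pure r g" and "degree f \<ge> 2" and "r \<ge> 1"
  shows "pure r (pcompose f g)"
proof -
  let ?d = "int (degree f)" and ?D = "int (degree g)"
  have wf: "weight_ge ?d (int r) (?d * int r) f" and wg: "weight_ge ?D (int r) (?D * int r) g"
    and f0: "coeff f 0 \<noteq> 0" "v (coeff f 0) = int r" and fl: "v (lead_coeff f) = 0"
    and g0: "coeff g 0 \<noteq> 0" "v (coeff g 0) = int r" and gl: "v (lead_coeff g) = 0"
    and D: "degree g > 0"
    using f g by (auto simp: pure_def)
  \<comment> \<open>Purity of \<open>g\<close> is multiplied by \<open>?d\<close>; the surplus
    \<open>(?d - 1) * int r * int i\<close> is then bounded using
    \<open>i \<le> degree g\<close>.\<close>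
  have "weight_ge (?d * ?D) (int r) (?D * int r) g"
    unfolding weight_ge_def
  proof (intro allI impI)
    fix i assume nz: "coeff g i \<noteq> 0"
    then have "i \<le> degree g" by (rule le_degree)
    then have "(?d - 1) * int r * int i \<le> (?d - 1) * int r * ?D"
      using assms(3) by (intro mult_left_mono) auto
    moreover have "?d * (?D * int r) \<le> ?d * (?D * v (coeff g i) + int r * int i)"
      using weight_geD[OF wg nz] by (intro mult_left_mono) auto
    ultimately show "?D * int r \<le> ?d * ?D * v (coeff g i) + int r * int i"
      by (simp add: algebra_simps)
  qed
  moreover have "weight_ge (?d * ?D) (?D * int r) (?d * ?D * int r) f"
    unfolding weight_ge_def
  proof (intro allI impI)
    fix i assume nz: "coeff f i \<noteq> 0"
    have "?D * (?d * int r) \<le> ?D * (?d * v (coeff f i) + int r * int i)"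
      using weight_geD[OF wf nz] by (intro mult_left_mono) auto
    then show "?d * ?D * int r \<le> ?d * ?D * v (coeff f i) + ?D * int r * int i"
      by (simp add: algebra_simps)
  qed
  ultimately have weight: "weight_ge (?d * ?D) (int r) (?d * ?D * int r) (pcompose f g)"
    by (intro weight_ge_pcompose) auto
  \<comment> \<open>The constant term of the composition is \<open>a + ?c * poly q ?c\<close>; the
    aim is that \<open>a\<close>, of valuation \<open>r\<close>, dominates.\<close>
  obtain a q where fq: "f = pCons a q" by (cases f)
  let ?c = "coeff g 0"
  have "weight_ge ?d (?d * int r) (?d * int r - int r) q"
    unfolding weight_ge_def
  proof (intro allI impI)
    fix i assume "coeff q i \<noteq> 0"
    then have "?d * int r \<le> ?d * v (coeff q i) + int r * (int i + 1)"
      using weight_geD[OF wf, of "Suc i"] by (simp add: fq algebra_simps)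
    moreover have "int r * int i * 1 \<le> int r * int i * ?d"
      using assms(3) by (intro mult_left_mono) auto
    ultimately show "?d * int r - int r \<le> ?d * v (coeff q i) + ?d * int r * int i"
      by (simp add: algebra_simps)
  qed
  \<comment> \<open>Evaluation at \<open>?c\<close> is composition with a constant polynomial, whose
    weight is \<open>?d * int r\<close>.\<close>
  moreover have "weight_ge ?d 0 (?d * int r) [:?c:]"
    using g0 by (intro weight_ge_const) simp
  ultimately have "weight_ge ?d 0 (?d * int r - int r) (pcompose q [:?c:])"
    by (intro weight_ge_pcompose) auto
  then have q_ge: "?d * int r - int r \<le> ?d * v (poly q ?c)" if "poly q ?c \<noteq> 0"
    using that weight_geD[of ?d 0 "?d * int r - int r" "pcompose q [:?c:]" 0]
    by (simp add: coeff_pcompose_0)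
  \<comment> \<open>Here degree at least 2 is decisive: it makes the lower bound
    \<open>?d * int r - int r\<close> positive.\<close>
  have "1 * int r < ?d * int r"
    using assms(3,4) by (intro mult_strict_right_mono) auto
  then have "0 < ?d * v (poly q ?c)" if "poly q ?c \<noteq> 0"
    using q_ge[OF that] by linarith
  then have q_pos: "0 < v (poly q ?c)" if "poly q ?c \<noteq> 0"
    using that by (simp add: zero_less_mult_iff)
  have a: "a \<noteq> 0" "v a = int r" using f0 fq by auto
  have dom: "v a < v (?c * poly q ?c)" if "?c * poly q ?c \<noteq> 0"
    using that q_pos a g0 by (simp add: val_mult)
  have "coeff (pcompose f g) 0 = a + ?c * poly q ?c"
    by (simp add: fq coeff_pcompose_0)
  then have "coeff (pcompose f g) 0 \<noteq> 0" "v (coeff (pcompose f g) 0) = int r"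
    using val_add_dominant[OF a(1) dom] a(2) by auto
  moreover have "v (lead_coeff (pcompose f g)) = 0"
  proof -
    have nz: "lead_coeff f \<noteq> 0" "lead_coeff g \<noteq> 0" using f0 g0 by auto
    have "v (lead_coeff (pcompose f g)) = v (lead_coeff f * lead_coeff g ^ degree f)"
      by (simp only: lead_coeff_comp[OF D])
    also have "\<dots> = v (lead_coeff f) + int (degree f) * v (lead_coeff g)"
      using nz by (simp only: val_mult val_power power_not_zero not_False_eq_True)
    finally show ?thesis using fl gl by simp
  qed
  ultimately show ?thesis
    unfolding pure_def using D assms(3) weight by (simp add: degree_pcompose)
qed

end

section \<open>The p-adic valuation\<close>

text \<open>An integer-valued form of \<open>padic_val\<close>, made to fit the locale
  \<open>valuation\<close>; its finite value at 0 is never consulted there.\<close>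

definition int_padic_val :: "nat \<Rightarrow> rat \<Rightarrow> int" where
  "int_padic_val p x = int (multiplicity (int p) (fst (quotient_of x)))
     - int (multiplicity (int p) (snd (quotient_of x)))"

lemma padic_val_eq: "x \<noteq> 0 \<Longrightarrow> padic_val p x = ereal (of_int (int_padic_val p x))"
  by (simp add: padic_val_def int_padic_val_def)

text \<open>Cross-multiplication with the reduced fraction frees the valuation from lowest terms, so
  that products and common denominators can be used.\<close>

lemma int_padic_val_divide:
  assumes "prime p" and "m \<noteq> 0" and "n \<noteq> 0"
  shows "int_padic_val p (of_int m / of_int n)
    = int (multiplicity (int p) m) - int (multiplicity (int p) n)"
proof -
  obtain a b where q: "quotient_of (of_int m / of_int n) = (a, b)"
    by (cases "quotient_of (of_int m / of_int n)")
  have b: "b > 0" and eq: "(of_int m / of_int n :: rat) = of_int a / of_int b"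
    using quotient_of_denom_pos[OF q] quotient_of_div[OF q] by auto
  then have "a \<noteq> 0" using assms by auto
  have "(of_int (m * b) :: rat) = of_int (a * n)"
    using eq b assms by (simp add: field_simps)
  then have "m * b = a * n" by (simp only: of_int_eq_iff)
  then have "multiplicity (int p) (m * b) = multiplicity (int p) (a * n)" by simp
  then have "multiplicity (int p) m + multiplicity (int p) b
      = multiplicity (int p) a + multiplicity (int p) n"
    using assms b \<open>a \<noteq> 0\<close> by (simp add: prime_elem_multiplicity_mult_distrib)
  then show ?thesis by (simp add: int_padic_val_def q)
qed

lemma min_multiplicity_le_add:
  fixes q m n :: int
  assumes "prime q" and "m \<noteq> 0" and "n \<noteq> 0" and "m + n \<noteq> 0"
  shows "min (multiplicity q m) (multiplicity q n) \<le> multiplicity q (m + n)"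
proof (rule multiplicity_geI)
  show "q ^ min (multiplicity q m) (multiplicity q n) dvd m + n"
    by (intro dvd_add) (auto intro: multiplicity_dvd')
qed (use assms in auto)

lemma valuation_int_padic_val:
  assumes "prime p"
  shows "valuation (int_padic_val p)"
proof
  fix x y :: rat
  assume x: "x \<noteq> 0" and y: "y \<noteq> 0"
  obtain a b where xab: "b \<noteq> 0" "x = of_int a / of_int b"
    by (metis quotient_of_denom_pos' quotient_of_div prod.collapse less_irrefl)
  obtain c e where yce: "e \<noteq> 0" "y = of_int c / of_int e"
    by (metis quotient_of_denom_pos' quotient_of_div prod.collapse less_irrefl)
  have nz: "a \<noteq> 0" "c \<noteq> 0" using x y xab yce by auto
  have p: "prime_elem (int p)" using assms by simp
  note vx = int_padic_val_divide[OF assms nz(1) xab(1), folded xab(2)]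
    and vy = int_padic_val_divide[OF assms nz(2) yce(1), folded yce(2)]
  have mult: "multiplicity (int p) (m * n) = multiplicity (int p) m + multiplicity (int p) n"
    if "m \<noteq> 0" "n \<noteq> 0" for m n
    using p that by (rule prime_elem_multiplicity_mult_distrib)
  have "x * y = of_int (a * c) / of_int (b * e)" using xab yce by simp
  then have "int_padic_val p (x * y)
      = int (multiplicity (int p) (a * c)) - int (multiplicity (int p) (b * e))"
    using int_padic_val_divide[OF assms, of "a * c" "b * e"] nz xab(1) yce(1) by simp
  then show "int_padic_val p (x * y) = int_padic_val p x + int_padic_val p y"
    unfolding vx vy using mult nz xab(1) yce(1) by simp
  assume xy: "x + y \<noteq> 0"
  have eq: "x + y = of_int (a * e + c * b) / of_int (b * e)"
    using xab yce by (simp add: field_simps)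
  then have nz': "a * e + c * b \<noteq> 0" using xy by fastforce
  have "min (multiplicity (int p) (a * e)) (multiplicity (int p) (c * b))
      \<le> multiplicity (int p) (a * e + c * b)"
    using assms nz nz' xab yce by (intro min_multiplicity_le_add) auto
  moreover have "int_padic_val p (x + y)
      = int (multiplicity (int p) (a * e + c * b)) - int (multiplicity (int p) (b * e))"
    unfolding eq using nz' xab yce by (intro int_padic_val_divide[OF assms]) auto
  ultimately show "min (int_padic_val p x) (int_padic_val p y) \<le> int_padic_val p (x + y)"
    using vx vy mult[OF nz(1) yce(1)] mult[OF nz(2) xab(1)] mult[OF xab(1) yce(1)] by linarith
qed

lemma pure_poly_imp_pure:
  assumes "prime p" and "r \<ge> 1" and "pure_poly p r f"
  shows "valuation.pure (int_padic_val p) r f"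
proof -
  interpret valuation "int_padic_val p" by (rule valuation_int_padic_val[OF assms(1)])
  let ?v = "int_padic_val p" and ?d = "int (degree f)"
  have lead: "padic_val p (lead_coeff f) = 0" and const: "padic_val p (coeff f 0) = ereal (real r)"
    and mid: "\<And>i. 1 \<le> i \<Longrightarrow> i < degree f \<Longrightarrow>
        padic_val p (coeff f i) / ereal (real (degree f - i)) \<ge> ereal (real r / real (degree f))"
    using assms(3) unfolding pure_poly_def by auto
  \<comment> \<open>A constant polynomial would need its only coefficient to have both valuation 0
    and valuation \<open>r \<ge> 1\<close>.\<close>
  have d: "degree f > 0" using lead const assms(2) by (cases "degree f = 0") auto
  have lead0: "lead_coeff f \<noteq> 0" using d by auto
  then have vl: "?v (lead_coeff f) = 0" using lead by (simp add: padic_val_eq)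
  have f0: "coeff f 0 \<noteq> 0" using const by (auto simp: padic_val_def)
  then have v0: "?v (coeff f 0) = int r" using const by (simp add: padic_val_eq)
  have "?d * int r \<le> ?d * ?v (coeff f i) + int r * int i" if nz: "coeff f i \<noteq> 0" for i
  proof -
    have "i \<le> degree f" using nz by (rule le_degree)
    then consider "i = 0" | "i = degree f" | "1 \<le> i" "i < degree f" by linarith
    then show ?thesis
    proof cases
      case 3
      have "real r / real (degree f) \<le> of_int (?v (coeff f i)) / real (degree f - i)"
        using mid[OF 3] 3 nz by (simp add: padic_val_eq)
      \<comment> \<open>Clearing the denominators turns the slope condition into an inequality of
        integer weights.\<close>
      then have "real r * real (degree f - i) \<le> of_int (?v (coeff f i)) * real (degree f)"
        using 3 by (simp add: field_simps del: of_nat_diff)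
      then have "of_int (int r * (?d - int i)) \<le> (of_int (?v (coeff f i) * ?d) :: real)"
        using 3 by (simp add: of_nat_diff)
      then have "int r * (?d - int i) \<le> ?v (coeff f i) * ?d" by (simp only: of_int_le_iff)
      then show ?thesis by (simp add: algebra_simps)
    qed (use v0 vl in auto)
  qed
  then show ?thesis
    unfolding pure_def weight_ge_def using d f0 v0 vl by auto
qed

section \<open>Iterates\<close>

lemma iterate_poly_Suc: "iterate_poly f (Suc n) = pcompose f (iterate_poly f n)"
  by (simp add: iterate_poly_def)

lemma degree_iterate_poly:
  fixes f :: "'a :: idom poly"
  shows "degree (iterate_poly f n) = degree f ^ n"
  by (induction n) (simp_all add: iterate_poly_Suc degree_pcompose, simp add: iterate_poly_def)

text \<open>The induction starts at 1, because the zeroth iterate is the variable, whose constant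
  term vanishes.\<close>

lemma (in valuation) pure_iterate_poly:
  assumes "pure r f" and "degree f \<ge> 2" and "r \<ge> 1" and "n \<ge> 1"
  shows "pure r (iterate_poly f n)"
  using assms(4)
proof (induction n rule: dec_induct)
  case base
  then show ?case using assms(1) by (simp add: iterate_poly_def pcompose_idR)
next
  case (step n)
  then show ?case using assms by (simp add: iterate_poly_Suc pure_pcompose)
qed

section \<open>Counting irreducible factors by degree\<close>

lemma degree_prod_mset_eq_sum_mset:
  fixes A :: "'a :: idom poly multiset"
  shows "0 \<notin># A \<Longrightarrow> degree (prod_mset A) = (\<Sum>q\<in>#A. degree q)"
  by (induction A) (auto simp: degree_mult_eq prod_mset_zero_iff)

lemma num_irreducible_factors_le:
  fixes h :: "rat poly"
  assumes "h \<noteq> 0" and "\<And>q. irreducible q \<Longrightarrow> q dvd h \<Longrightarrow> m \<le> degree q"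
  shows "num_irreducible_factors h * m \<le> degree h"
proof -
  let ?A = "prime_factorization h"
  \<comment> \<open>The prime factorization recovers \<open>h\<close> only up to a unit, which does
    not affect the degree.\<close>
  have "degree h = degree (normalize h)"
    using assms(1) by (intro antisym dvd_imp_degree_le) auto
  also have "\<dots> = degree (prod_mset ?A)"
    using assms(1) by (simp add: prod_mset_prime_factorization)
  also have "\<dots> = (\<Sum>q\<in>#?A. degree q)"
    by (rule degree_prod_mset_eq_sum_mset) auto
  also have "\<dots> \<ge> (\<Sum>q\<in>#?A. m)"
    using assms(2) by (intro sum_mset_mono)
      (auto dest: in_prime_factors_imp_prime in_prime_factors_imp_dvd intro: prime_elem_imp_irreducible)
  finally show ?thesis by (simp add: num_irreducible_factors_def)
qed

text \<open>After division by the gcd, \<open>D div gcd D r\<close> is coprime to the cofactor of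
  \<open>e\<close>, hence divides \<open>e\<close> itself.\<close>

lemma div_gcd_le_of_dvd_mult:
  fixes D r e :: nat
  assumes "D dvd r * e" and "D > 0" and "e > 0"
  shows "D div gcd D r \<le> e"
proof -
  let ?g = "gcd D r"
  have g: "?g > 0" using assms by simp
  have "(D div ?g) * ?g dvd (r div ?g) * e * ?g"
    using assms(1) by (simp add: mult.commute mult.left_commute)
  then have "D div ?g dvd (r div ?g) * e"
    using g by (metis dvd_times_right_cancel_iff less_irrefl)
  moreover have "coprime (D div ?g) (r div ?g)"
    using assms by (intro div_gcd_coprime) simp
  ultimately have "D div ?g dvd e"
    by (simp add: coprime_dvd_mult_right_iff)
  then show ?thesis using assms(3) by (rule dvd_imp_le)
qed

theorem theorem4p9:
  fixes p r d :: nat and f :: "rat poly"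
  assumes "prime p" and "r \<ge> 1" and "degree f = d" and "pure_poly p r f"
  shows "(\<forall>n\<ge>1. num_irreducible_factors (iterate_poly f n) \<le> gcd (d ^ n) r \<and>
            (\<forall>g. irreducible g \<and> g dvd iterate_poly f n \<longrightarrow>
               real (degree g) \<ge> real (d ^ n) / real (gcd (d ^ n) r))) \<and>
         eventually_stable f"
proof -
  interpret valuation "int_padic_val p" by (rule valuation_int_padic_val[OF assms(1)])
  have pure: "pure r f" using pure_poly_imp_pure assms by blast
  then have d: "d > 0" using assms(3) by (simp add: pure_def)
  have deg: "d ^ n div gcd (d ^ n) r \<le> degree g"
    if "n \<ge> 1" and "irreducible g" and "g dvd iterate_poly f n" for n g
  proof (rule div_gcd_le_of_dvd_mult)
    show "d ^ n dvd r * degree g"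
    \<comment> \<open>For \<open>d = 1\<close> the divisor \<open>d ^ n\<close> is 1, so purity of
      the iterate is not called for.\<close>
    proof (cases "d = 1")
      case False
      then have "pure r (iterate_poly f n)"
        using pure d assms that by (intro pure_iterate_poly) auto
      then show ?thesis
        using pure_dvd_imp_degree_dvd that assms(3) by (metis degree_iterate_poly)
    qed simp
    show "degree g > 0"
      using that(2) by (auto simp: irreducible_def is_unit_iff_degree)
  qed (use d in simp)
  have num: "num_irreducible_factors (iterate_poly f n) \<le> gcd (d ^ n) r" if "n \<ge> 1" for n
  proof -
    let ?m = "d ^ n div gcd (d ^ n) r"
    have D: "degree (iterate_poly f n) = d ^ n" using assms(3) by (simp add: degree_iterate_poly)
    have "iterate_poly f n \<noteq> 0" using D d by auto
    then have "num_irreducible_factors (iterate_poly f n) * ?m \<le> d ^ n"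
      using num_irreducible_factors_le deg[OF that] D by metis
    also have "d ^ n = gcd (d ^ n) r * ?m" by simp
    finally have "num_irreducible_factors (iterate_poly f n) * ?m \<le> gcd (d ^ n) r * ?m" .
    moreover have "?m > 0" using d by (simp add: div_greater_zero_iff)
    ultimately show ?thesis by (simp only: mult_le_cancel2)
  qed
  have "real (d ^ n) / real (gcd (d ^ n) r) \<le> real (degree g)"
    if "n \<ge> 1" and "irreducible g" and "g dvd iterate_poly f n" for n g
    \<comment> \<open>The gcd divides \<open>d ^ n\<close>, so the real quotient agrees with the
      natural number quotient.\<close>
    using deg[OF that] by (metis gcd_dvd1 of_nat_le_iff real_of_nat_div)
  moreover have "eventually_stable f"
    unfolding eventually_stable_def
  proof (intro exI allI impI)
    fix n :: nat assume "n \<ge> 1"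
    then have "num_irreducible_factors (iterate_poly f n) \<le> gcd (d ^ n) r" by (rule num)
    \<comment> \<open>Bounding the gcd by \<open>r\<close> gives a constant independent of
      \<open>n\<close>.\<close>
    also have "\<dots> \<le> r" using assms(2) by (intro gcd_le2_nat) simp
    finally show "num_irreducible_factors (iterate_poly f n) \<le> r" .
  qed
  ultimately show ?thesis using num by blast
qed

end
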